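(* Let $R$ be a commutative ring, let $n$ be a positive integer, and let $A\in T_n(R)$ with diagonal entries $A_{11},\dots,A_{nn}$. If $2\in J(R)$, then the following are equivalent: (1) $A$ is perfectly $J$-clean in $T_n(R)$. (2) Each $A_{ii}$ ($1\le i\le n$) is perfectly $J$-clean in $R$.
   Context: Rings are associative with identity. $J(S)$ is the Jacobson radical of a ring $S$. For $a\in S$, $comm(a)=\{x\in S\mid xa=ax\}$ and $comm^2(a)=\{x\in S\mid xy=yx \text{ for all } y\in comm(a)\}$. An element $a\in S$ is perfectly $J$-clean if there is an idempotent $e\in comm^2(a)$ with $a-e\in J(S)$. $T_n(R)$ is the ring of $n\times n$ upper triangular matrices over $R$. *)

theory Defs
  imports "HOL-Algebra.Ideal" "Jordan_Normal_Form.Matrix"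
begin

definition left_ideal :: "'a set \<Rightarrow> ('a, 'm) ring_scheme \<Rightarrow> bool" where
  "left_ideal I S \<longleftrightarrow> additive_subgroup I S \<and> (\<forall>s\<in>carrier S. \<forall>x\<in>I. s \<otimes>\<^bsub>S\<^esub> x \<in> I)"

definition maximal_left_ideal :: "'a set \<Rightarrow> ('a, 'm) ring_scheme \<Rightarrow> bool" where
  "maximal_left_ideal M S \<longleftrightarrow> left_ideal M S \<and> M \<noteq> carrier S \<and>
     (\<forall>I. left_ideal I S \<longrightarrow> M \<subseteq> I \<longrightarrow> I = M \<or> I = carrier S)"

text \<open>The intersection of all maximal left ideals; it is taken inside the carrier, so that the
  zero ring, which has no maximal left ideals, is its own radical.\<close>

definition jacobson_radical :: "('a, 'm) ring_scheme \<Rightarrow> 'a set" where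
  "jacobson_radical S = {x \<in> carrier S. \<forall>M. maximal_left_ideal M S \<longrightarrow> x \<in> M}"

definition ring_comm :: "('a, 'm) ring_scheme \<Rightarrow> 'a \<Rightarrow> 'a set" where
  "ring_comm S a = {x \<in> carrier S. x \<otimes>\<^bsub>S\<^esub> a = a \<otimes>\<^bsub>S\<^esub> x}"

definition ring_comm2 :: "('a, 'm) ring_scheme \<Rightarrow> 'a \<Rightarrow> 'a set" where
  "ring_comm2 S a = {x \<in> carrier S. \<forall>y\<in>ring_comm S a. x \<otimes>\<^bsub>S\<^esub> y = y \<otimes>\<^bsub>S\<^esub> x}"

definition perfectly_J_clean :: "('a, 'm) ring_scheme \<Rightarrow> 'a \<Rightarrow> bool" where
  "perfectly_J_clean S a \<longleftrightarrow> a \<in> carrier S \<and>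
     (\<exists>e\<in>ring_comm2 S a. e \<otimes>\<^bsub>S\<^esub> e = e \<and> a \<ominus>\<^bsub>S\<^esub> e \<in> jacobson_radical S)"

text \<open>The library's matrix ring \<^const>\<open>ring_mat\<close> takes its coefficients from a type class, so the
  operations are built here from those of the coefficient ring record. Indices run over
  \<open>0, \<dots>, n - 1\<close>.\<close>

definition upper_triangular_ring :: "nat \<Rightarrow> ('a, 'm) ring_scheme \<Rightarrow> 'a mat ring" where
  "upper_triangular_ring n R = \<lparr>
     carrier = {A \<in> carrier_mat n n.
       (\<forall>i<n. \<forall>j<n. A $$ (i, j) \<in> carrier R) \<and> (\<forall>i<n. \<forall>j<i. A $$ (i, j) = \<zero>\<^bsub>R\<^esub>)},
     monoid.mult = (\<lambda>A B. mat n n (\<lambda>(i, j). \<Oplus>\<^bsub>R\<^esub>k\<in>{..<n}. A $$ (i, k) \<otimes>\<^bsub>R\<^esub> B $$ (k, j))),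
     monoid.one = mat n n (\<lambda>(i, j). if i = j then \<one>\<^bsub>R\<^esub> else \<zero>\<^bsub>R\<^esub>),
     ring.zero = mat n n (\<lambda>(i, j). \<zero>\<^bsub>R\<^esub>),
     ring.add = (\<lambda>A B. mat n n (\<lambda>(i, j). A $$ (i, j) \<oplus>\<^bsub>R\<^esub> B $$ (i, j)))\<rparr>"

lemma (in ring) finsum_swap:
  assumes "finite A" "finite B" "\<And>x y. x \<in> A \<Longrightarrow> y \<in> B \<Longrightarrow> f x y \<in> carrier R"
  shows "(\<Oplus>x\<in>A. \<Oplus>y\<in>B. f x y) = (\<Oplus>y\<in>B. \<Oplus>x\<in>A. f x y)"
  using assms(1,3)
proof (induction A rule: finite_induct)
  case empty
  then show ?case by simp
next
  case (insert a A)
  have "(\<Oplus>x\<in>insert a A. \<Oplus>y\<in>B. f x y) = (\<Oplus>y\<in>B. f a y) \<oplus> (\<Oplus>y\<in>B. \<Oplus>x\<in>A. f x y)"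
    using insert by (subst finsum_insert) (auto intro!: finsum_closed)
  also have "\<dots> = (\<Oplus>y\<in>B. f a y \<oplus> (\<Oplus>x\<in>A. f x y))"
    using insert by (subst finsum_addf) (auto intro!: finsum_closed)
  also have "\<dots> = (\<Oplus>y\<in>B. \<Oplus>x\<in>insert a A. f x y)"
    using insert by (intro finsum_cong') (auto intro!: finsum_closed)
  finally show ?case .
qed

lemma (in ring) ring_upper_triangular_ring: "ring (upper_triangular_ring n R)"
proof -
  let ?T = "upper_triangular_ring n R"
  have carr: "A $$ (i, j) \<in> carrier R" if "A \<in> carrier ?T" "i < n" "j < n" for A i j
    using that by (auto simp: upper_triangular_ring_def)
  have dim: "dim_row A = n" "dim_col A = n" if "A \<in> carrier ?T" for A
    using that by (auto simp: upper_triangular_ring_def)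
  have low: "A $$ (i, j) = \<zero>" if "A \<in> carrier ?T" "i < n" "j < i" for A i j
    using that by (auto simp: upper_triangular_ring_def)
  have mult: "A \<otimes>\<^bsub>?T\<^esub> B = mat n n (\<lambda>(i, j). \<Oplus>k\<in>{..<n}. A $$ (i, k) \<otimes> B $$ (k, j))" for A B
    by (simp add: upper_triangular_ring_def)
  have add: "A \<oplus>\<^bsub>?T\<^esub> B = mat n n (\<lambda>(i, j). A $$ (i, j) \<oplus> B $$ (i, j))" for A B
    by (simp add: upper_triangular_ring_def)
  have one: "\<one>\<^bsub>?T\<^esub> = mat n n (\<lambda>(i, j). if i = j then \<one> else \<zero>)"
    by (simp add: upper_triangular_ring_def)
  have zero: "\<zero>\<^bsub>?T\<^esub> = mat n n (\<lambda>(i, j). \<zero>)"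
    by (simp add: upper_triangular_ring_def)
  have memI: "mat n n f \<in> carrier ?T"
    if "\<And>i j. i < n \<Longrightarrow> j < n \<Longrightarrow> f (i, j) \<in> carrier R" "\<And>i j. i < n \<Longrightarrow> j < i \<Longrightarrow> f (i, j) = \<zero>" for f
    using that by (auto simp: upper_triangular_ring_def)
  have sumone1: "(\<Oplus>k\<in>{..<n}. (if i = k then \<one> else \<zero>) \<otimes> f k) = f i"
    if "i < n" "\<And>k. k < n \<Longrightarrow> f k \<in> carrier R" for i f
  proof -
    have "(\<Oplus>k\<in>{..<n}. (if i = k then \<one> else \<zero>) \<otimes> f k) = (\<Oplus>k\<in>{..<n}. if i = k then f k else \<zero>)"
      using that by (intro finsum_cong') auto
    then show ?thesis using that finsum_singleton[of i "{..<n}" f] by (auto simp: Pi_def)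
  qed
  have sumone2: "(\<Oplus>k\<in>{..<n}. f k \<otimes> (if k = i then \<one> else \<zero>)) = f i"
    if "i < n" "\<And>k. k < n \<Longrightarrow> f k \<in> carrier R" for i f
  proof -
    have "(\<Oplus>k\<in>{..<n}. f k \<otimes> (if k = i then \<one> else \<zero>)) = (\<Oplus>k\<in>{..<n}. if i = k then f k else \<zero>)"
      using that by (intro finsum_cong') auto
    then show ?thesis using that finsum_singleton[of i "{..<n}" f] by (auto simp: Pi_def)
  qed
  have mclosed: "A \<otimes>\<^bsub>?T\<^esub> B \<in> carrier ?T" if A: "A \<in> carrier ?T" and B: "B \<in> carrier ?T" for A B
    unfolding mult
  proof (rule memI)
    fix i j assume "i < n" "j < n"
    then show "(case (i, j) of (i, j) \<Rightarrow> \<Oplus>k\<in>{..<n}. A $$ (i, k) \<otimes> B $$ (k, j)) \<in> carrier R"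
      using A B carr by (auto intro!: finsum_closed)
  next
    fix i j assume ij: "i < n" "j < i"
    have "A $$ (i, k) \<otimes> B $$ (k, j) = \<zero>" if "k < n" for k
    proof (cases "k < i")
      case True
      then show ?thesis using low[OF A ij(1) True] carr[OF B] ij that by simp
    next
      case False
      then show ?thesis using low[OF B that] carr[OF A] ij that by simp
    qed
    then have "(\<Oplus>k\<in>{..<n}. A $$ (i, k) \<otimes> B $$ (k, j)) = (\<Oplus>k\<in>{..<n}. \<zero>)"
      by (intro finsum_cong') auto
    then show "(case (i, j) of (i, j) \<Rightarrow> \<Oplus>k\<in>{..<n}. A $$ (i, k) \<otimes> B $$ (k, j)) = \<zero>"
      by simp
  qed
  have aclosed: "A \<oplus>\<^bsub>?T\<^esub> B \<in> carrier ?T" if "A \<in> carrier ?T" "B \<in> carrier ?T" for A B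
    unfolding add using that by (intro memI) (auto simp: carr low)
  have oneclosed: "\<one>\<^bsub>?T\<^esub> \<in> carrier ?T"
    unfolding one by (intro memI) auto
  have zeroclosed: "\<zero>\<^bsub>?T\<^esub> \<in> carrier ?T"
    unfolding zero by (intro memI) auto
  show ?thesis
  proof (rule ringI)
    show "abelian_group ?T"
    proof (rule abelian_groupI)
      fix A assume A: "A \<in> carrier ?T"
      show "\<exists>B\<in>carrier ?T. B \<oplus>\<^bsub>?T\<^esub> A = \<zero>\<^bsub>?T\<^esub>"
      proof
        show "mat n n (\<lambda>(i, j). \<ominus> (A $$ (i, j))) \<in> carrier ?T"
          using A by (intro memI) (auto simp: carr low)
        show "mat n n (\<lambda>(i, j). \<ominus> (A $$ (i, j))) \<oplus>\<^bsub>?T\<^esub> A = \<zero>\<^bsub>?T\<^esub>"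
          unfolding add zero using A by (intro eq_matI) (auto simp: carr l_neg)
      qed
    qed (auto intro!: eq_matI simp: aclosed zeroclosed, auto simp: add zero carr dim a_ac)
    show "monoid ?T"
    proof (rule monoidI)
      fix A B C assume A: "A \<in> carrier ?T" and B: "B \<in> carrier ?T" and C: "C \<in> carrier ?T"
      show "A \<otimes>\<^bsub>?T\<^esub> B \<otimes>\<^bsub>?T\<^esub> C = A \<otimes>\<^bsub>?T\<^esub> (B \<otimes>\<^bsub>?T\<^esub> C)"
      proof (rule eq_matI)
        fix i j assume "i < dim_row (A \<otimes>\<^bsub>?T\<^esub> (B \<otimes>\<^bsub>?T\<^esub> C))" "j < dim_col (A \<otimes>\<^bsub>?T\<^esub> (B \<otimes>\<^bsub>?T\<^esub> C))"
        then have ij: "i < n" "j < n" by (auto simp: mult)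
        have "(A \<otimes>\<^bsub>?T\<^esub> B \<otimes>\<^bsub>?T\<^esub> C) $$ (i, j) =
            (\<Oplus>k\<in>{..<n}. (\<Oplus>l\<in>{..<n}. A $$ (i, l) \<otimes> B $$ (l, k)) \<otimes> C $$ (k, j))"
          unfolding mult using ij A B C
          by (simp, intro finsum_cong') (auto simp: carr intro!: finsum_closed)
        also have "\<dots> = (\<Oplus>k\<in>{..<n}. \<Oplus>l\<in>{..<n}. A $$ (i, l) \<otimes> B $$ (l, k) \<otimes> C $$ (k, j))"
          using ij A B C
          by (intro finsum_cong' finsum_ldistr) (auto simp: carr intro!: finsum_closed)
        also have "\<dots> = (\<Oplus>l\<in>{..<n}. \<Oplus>k\<in>{..<n}. A $$ (i, l) \<otimes> B $$ (l, k) \<otimes> C $$ (k, j))"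
          using ij A B C by (intro finsum_swap) (auto simp: carr)
        also have "\<dots> = (\<Oplus>l\<in>{..<n}. \<Oplus>k\<in>{..<n}. A $$ (i, l) \<otimes> (B $$ (l, k) \<otimes> C $$ (k, j)))"
          using ij A B C by (intro finsum_cong') (auto simp: carr m_assoc intro!: finsum_closed)
        also have "\<dots> = (\<Oplus>l\<in>{..<n}. A $$ (i, l) \<otimes> (\<Oplus>k\<in>{..<n}. B $$ (l, k) \<otimes> C $$ (k, j)))"
          using ij A B C
          by (intro finsum_cong' finsum_rdistr[symmetric]) (auto simp: carr intro!: finsum_closed)
        also have "\<dots> = (A \<otimes>\<^bsub>?T\<^esub> (B \<otimes>\<^bsub>?T\<^esub> C)) $$ (i, j)"
          unfolding mult using ij A B C
          by (simp, intro finsum_cong') (auto simp: carr intro!: finsum_closed)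
        finally show "(A \<otimes>\<^bsub>?T\<^esub> B \<otimes>\<^bsub>?T\<^esub> C) $$ (i, j) = (A \<otimes>\<^bsub>?T\<^esub> (B \<otimes>\<^bsub>?T\<^esub> C)) $$ (i, j)" .
      qed (auto simp: mult)
    next
      fix A assume A: "A \<in> carrier ?T"
      show "\<one>\<^bsub>?T\<^esub> \<otimes>\<^bsub>?T\<^esub> A = A"
      proof (rule eq_matI)
        fix i j assume "i < dim_row A" "j < dim_col A"
        then have ij: "i < n" "j < n" using dim[OF A] by auto
        have "(\<one>\<^bsub>?T\<^esub> \<otimes>\<^bsub>?T\<^esub> A) $$ (i, j) = (\<Oplus>k\<in>{..<n}. (if i = k then \<one> else \<zero>) \<otimes> A $$ (k, j))"
          unfolding mult one using ij A by (simp, intro finsum_cong') (auto simp: carr)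
        then show "(\<one>\<^bsub>?T\<^esub> \<otimes>\<^bsub>?T\<^esub> A) $$ (i, j) = A $$ (i, j)"
          using sumone1[OF ij(1), of "\<lambda>k. A $$ (k, j)"] carr[OF A] ij by simp
      qed (auto simp: mult dim[OF A])
      show "A \<otimes>\<^bsub>?T\<^esub> \<one>\<^bsub>?T\<^esub> = A"
      proof (rule eq_matI)
        fix i j assume "i < dim_row A" "j < dim_col A"
        then have ij: "i < n" "j < n" using dim[OF A] by auto
        have "(A \<otimes>\<^bsub>?T\<^esub> \<one>\<^bsub>?T\<^esub>) $$ (i, j) = (\<Oplus>k\<in>{..<n}. A $$ (i, k) \<otimes> (if k = j then \<one> else \<zero>))"
          unfolding mult one using ij A by (simp, intro finsum_cong') (auto simp: carr)
        then show "(A \<otimes>\<^bsub>?T\<^esub> \<one>\<^bsub>?T\<^esub>) $$ (i, j) = A $$ (i, j)"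
          using sumone2[OF ij(2), of "\<lambda>k. A $$ (i, k)"] carr[OF A] ij by simp
      qed (auto simp: mult dim[OF A])
    qed (auto simp: mclosed oneclosed)
  next
    fix A B C assume A: "A \<in> carrier ?T" and B: "B \<in> carrier ?T" and C: "C \<in> carrier ?T"
    show "(A \<oplus>\<^bsub>?T\<^esub> B) \<otimes>\<^bsub>?T\<^esub> C = A \<otimes>\<^bsub>?T\<^esub> C \<oplus>\<^bsub>?T\<^esub> B \<otimes>\<^bsub>?T\<^esub> C"
    proof (rule eq_matI)
      fix i j assume "i < dim_row (A \<otimes>\<^bsub>?T\<^esub> C \<oplus>\<^bsub>?T\<^esub> B \<otimes>\<^bsub>?T\<^esub> C)" "j < dim_col (A \<otimes>\<^bsub>?T\<^esub> C \<oplus>\<^bsub>?T\<^esub> B \<otimes>\<^bsub>?T\<^esub> C)"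
      then have ij: "i < n" "j < n" by (auto simp: add)
      have "((A \<oplus>\<^bsub>?T\<^esub> B) \<otimes>\<^bsub>?T\<^esub> C) $$ (i, j) =
          (\<Oplus>k\<in>{..<n}. A $$ (i, k) \<otimes> C $$ (k, j) \<oplus> B $$ (i, k) \<otimes> C $$ (k, j))"
        unfolding mult add using ij A B C by (simp, intro finsum_cong') (auto simp: carr l_distr)
      also have "\<dots> = (A \<otimes>\<^bsub>?T\<^esub> C \<oplus>\<^bsub>?T\<^esub> B \<otimes>\<^bsub>?T\<^esub> C) $$ (i, j)"
        unfolding mult add using ij A B C by (simp, intro finsum_addf) (auto simp: carr)
      finally show "((A \<oplus>\<^bsub>?T\<^esub> B) \<otimes>\<^bsub>?T\<^esub> C) $$ (i, j) = (A \<otimes>\<^bsub>?T\<^esub> C \<oplus>\<^bsub>?T\<^esub> B \<otimes>\<^bsub>?T\<^esub> C) $$ (i, j)" .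
    qed (auto simp: mult add)
    show "C \<otimes>\<^bsub>?T\<^esub> (A \<oplus>\<^bsub>?T\<^esub> B) = C \<otimes>\<^bsub>?T\<^esub> A \<oplus>\<^bsub>?T\<^esub> C \<otimes>\<^bsub>?T\<^esub> B"
    proof (rule eq_matI)
      fix i j assume "i < dim_row (C \<otimes>\<^bsub>?T\<^esub> A \<oplus>\<^bsub>?T\<^esub> C \<otimes>\<^bsub>?T\<^esub> B)" "j < dim_col (C \<otimes>\<^bsub>?T\<^esub> A \<oplus>\<^bsub>?T\<^esub> C \<otimes>\<^bsub>?T\<^esub> B)"
      then have ij: "i < n" "j < n" by (auto simp: add)
      have "(C \<otimes>\<^bsub>?T\<^esub> (A \<oplus>\<^bsub>?T\<^esub> B)) $$ (i, j) =
          (\<Oplus>k\<in>{..<n}. C $$ (i, k) \<otimes> A $$ (k, j) \<oplus> C $$ (i, k) \<otimes> B $$ (k, j))"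
        unfolding mult add using ij A B C by (simp, intro finsum_cong') (auto simp: carr r_distr)
      also have "\<dots> = (C \<otimes>\<^bsub>?T\<^esub> A \<oplus>\<^bsub>?T\<^esub> C \<otimes>\<^bsub>?T\<^esub> B) $$ (i, j)"
        unfolding mult add using ij A B C by (simp, intro finsum_addf) (auto simp: carr)
      finally show "(C \<otimes>\<^bsub>?T\<^esub> (A \<oplus>\<^bsub>?T\<^esub> B)) $$ (i, j) = (C \<otimes>\<^bsub>?T\<^esub> A \<oplus>\<^bsub>?T\<^esub> C \<otimes>\<^bsub>?T\<^esub> B) $$ (i, j)" .
    qed (auto simp: mult add)
  qed
qed

end

theory Submission
  imports Defs "HOL-Algebra.Subrings"
begin

text \<open>Write \<open>T\<close> for the triangular matrix ring, \<open>J\<close> for the radical of \<open>R\<close> and \<open>a\<^sub>i\<close> for the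
  diagonal entries of \<open>A\<close>. The double commutant \<open>C\<close> of \<open>A\<close> in \<open>T\<close> is a commutative
  \<open>R\<close>-algebra in which the product of the \<open>A - a\<^sub>i\<close> vanishes. If the \<open>a\<^sub>i\<close> are units, this makes
  \<open>A\<close> invertible, so the radical of \<open>T\<close> consists of the matrices with diagonal in \<open>J\<close>.
  If \<open>a\<^sub>i - e\<^sub>i \<in> J\<close> with \<open>e\<^sub>i\<close> idempotent, put
  \<open>p\<^sub>i = e\<^sub>i + (1 - e\<^sub>i)(A - a\<^sub>i)\<close> and \<open>q\<^sub>i = (1 - e\<^sub>i) + e\<^sub>i(A - a\<^sub>i)\<close>. Then \<open>p\<^sub>i q\<^sub>i = A - a\<^sub>i\<close>,
  and \<open>p\<^sub>i\<close>, \<open>q\<^sub>j\<close> are comaximal, because on the component where \<open>e\<^sub>i = 0\<close> and \<open>e\<^sub>j = 1\<close>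
  their difference \<open>a\<^sub>j - a\<^sub>i\<close> lies in \<open>1 + J\<close>. Hence the products \<open>P\<close> of the \<open>p\<^sub>i\<close> and \<open>Q\<close> of
  the \<open>q\<^sub>i\<close> satisfy \<open>PQ = 0\<close> and \<open>uP + vQ = 1\<close> for some \<open>u\<close>, \<open>v\<close> in \<open>C\<close>, and \<open>uP\<close> is an idempotent
  of \<open>C\<close> with diagonal entries \<open>e\<^sub>i\<close>.\<close>

section \<open>The Jacobson radical\<close>

lemma (in ring) left_idealI:
  assumes "I \<subseteq> carrier R" "\<zero> \<in> I"
    and "\<And>x y. x \<in> I \<Longrightarrow> y \<in> I \<Longrightarrow> x \<oplus> y \<in> I"
    and "\<And>s x. s \<in> carrier R \<Longrightarrow> x \<in> I \<Longrightarrow> s \<otimes> x \<in> I"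
  shows "left_ideal I R"
proof -
  have "\<ominus> x \<in> I" if "x \<in> I" for x
    using assms(4)[of "\<ominus> \<one>" x] that assms(1) by (auto simp: l_minus)
  then have "subgroup I (add_monoid R)"
    using assms by (intro add.subgroupI) auto
  then show ?thesis
    using assms(4) by (auto simp: left_ideal_def additive_subgroup_def)
qed

lemma (in ring) left_idealD:
  assumes "left_ideal I R"
  shows "I \<subseteq> carrier R" "\<zero> \<in> I"
    and "x \<in> I \<Longrightarrow> y \<in> I \<Longrightarrow> x \<oplus> y \<in> I"
    and "x \<in> I \<Longrightarrow> \<ominus> x \<in> I"
    and "s \<in> carrier R \<Longrightarrow> x \<in> I \<Longrightarrow> s \<otimes> x \<in> I"
proof -
  interpret additive_subgroup I R
    using assms by (simp add: left_ideal_def)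
  show "I \<subseteq> carrier R" "\<zero> \<in> I"
    by (auto simp: a_subset)
  show "x \<in> I \<Longrightarrow> y \<in> I \<Longrightarrow> x \<oplus> y \<in> I" "x \<in> I \<Longrightarrow> \<ominus> x \<in> I"
    by (auto simp: a_inv_closed)
  show "s \<in> carrier R \<Longrightarrow> x \<in> I \<Longrightarrow> s \<otimes> x \<in> I"
    using assms by (simp add: left_ideal_def)
qed

lemma (in ring) left_ideal_eq_carrier_iff:
  assumes "left_ideal I R"
  shows "I = carrier R \<longleftrightarrow> \<one> \<in> I"
proof
  assume "\<one> \<in> I"
  then have "s \<in> I" if "s \<in> carrier R" for s
    using left_idealD(5)[OF assms that, of \<one>] that by simp
  then show "I = carrier R"
    using left_idealD(1)[OF assms] by auto
qed simp

lemma (in ring) left_ideal_principal: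
  assumes "x \<in> carrier R"
  shows "left_ideal {s \<otimes> x | s. s \<in> carrier R} R"
proof (rule left_idealI)
  show "\<zero> \<in> {s \<otimes> x | s. s \<in> carrier R}"
    using assms by (auto intro!: exI[of _ \<zero>])
next
  fix y z assume "y \<in> {s \<otimes> x | s. s \<in> carrier R}" "z \<in> {s \<otimes> x | s. s \<in> carrier R}"
  then show "y \<oplus> z \<in> {s \<otimes> x | s. s \<in> carrier R}"
    using assms by (auto simp: l_distr[symmetric])
next
  fix t y assume "t \<in> carrier R" "y \<in> {s \<otimes> x | s. s \<in> carrier R}"
  then show "t \<otimes> y \<in> {s \<otimes> x | s. s \<in> carrier R}"
    using assms by (auto simp: m_assoc[symmetric])
qed (use assms in auto)

lemma (in ring) left_ideal_sum:
  assumes I: "left_ideal I R" and J: "left_ideal J R"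
  shows "left_ideal {y \<oplus> z | y z. y \<in> I \<and> z \<in> J} R"
proof (rule left_idealI)
  note c = subsetD[OF left_idealD(1)[OF I]] subsetD[OF left_idealD(1)[OF J]]
  show "{y \<oplus> z | y z. y \<in> I \<and> z \<in> J} \<subseteq> carrier R"
    using c by auto
  show "\<zero> \<in> {y \<oplus> z | y z. y \<in> I \<and> z \<in> J}"
    using left_idealD(2)[OF I] left_idealD(2)[OF J] by force
  fix u v assume "u \<in> {y \<oplus> z | y z. y \<in> I \<and> z \<in> J}" "v \<in> {y \<oplus> z | y z. y \<in> I \<and> z \<in> J}"
  then obtain y z y' z' where *: "y \<in> I" "z \<in> J" "y' \<in> I" "z' \<in> J" "u = y \<oplus> z" "v = y' \<oplus> z'"
    by auto
  then have "u \<oplus> v = (y \<oplus> y') \<oplus> (z \<oplus> z')"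
    using c by (simp add: a_ac)
  then show "u \<oplus> v \<in> {y \<oplus> z | y z. y \<in> I \<and> z \<in> J}"
    using * left_idealD(3)[OF I] left_idealD(3)[OF J] by blast
next
  note c = subsetD[OF left_idealD(1)[OF I]] subsetD[OF left_idealD(1)[OF J]]
  fix s u assume s: "s \<in> carrier R" and "u \<in> {y \<oplus> z | y z. y \<in> I \<and> z \<in> J}"
  then obtain y z where *: "y \<in> I" "z \<in> J" "u = y \<oplus> z"
    by auto
  then have "s \<otimes> u = s \<otimes> y \<oplus> s \<otimes> z"
    using c s by (simp add: r_distr)
  then show "s \<otimes> u \<in> {y \<oplus> z | y z. y \<in> I \<and> z \<in> J}"
    using * left_idealD(5)[OF I s] left_idealD(5)[OF J s] by blast
qed

text \<open>Zorn's lemma on the left ideals that contain \<open>I\<close> and omit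
  \<open>\<one>\<close>. Expressing properness by the absence of \<open>\<one>\<close> makes it pass
  to unions of chains.\<close>

lemma (in ring) exists_maximal_left_ideal:
  assumes "left_ideal I R" "\<one> \<notin> I"
  obtains M where "maximal_left_ideal M R" "I \<subseteq> M"
proof -
  define F where "F = {K. left_ideal K R \<and> I \<subseteq> K \<and> \<one> \<notin> K}"
  have "\<exists>M\<in>F. \<forall>X\<in>F. M \<subseteq> X \<longrightarrow> X = M"
  proof (rule subset_Zorn_nonempty)
    show "F \<noteq> {}"
      using assms by (auto simp: F_def)
  next
    fix \<C> assume ne: "\<C> \<noteq> {}" and ch: "subset.chain F \<C>"
    then have sub: "\<And>K. K \<in> \<C> \<Longrightarrow> left_ideal K R \<and> I \<subseteq> K \<and> \<one> \<notin> K"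
      by (auto simp: F_def subset.chain_def)
    have tot: "K \<subseteq> L \<or> L \<subseteq> K" if "K \<in> \<C>" "L \<in> \<C>" for K L
      using ch that by (auto simp: subset.chain_def)
    have "left_ideal (\<Union>\<C>) R"
    proof (rule left_idealI)
      show "\<Union>\<C> \<subseteq> carrier R"
        using sub left_idealD(1) by blast
      show "\<zero> \<in> \<Union>\<C>"
        using sub ne left_idealD(2) by blast
      fix x y assume "x \<in> \<Union>\<C>" "y \<in> \<Union>\<C>"
      then obtain K where "K \<in> \<C>" "x \<in> K" "y \<in> K"
        using tot by blast
      then show "x \<oplus> y \<in> \<Union>\<C>"
        using sub left_idealD(3)[of K] by blast
    next
      fix s x assume "s \<in> carrier R" "x \<in> \<Union>\<C>"
      then show "s \<otimes> x \<in> \<Union>\<C>"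
        using sub left_idealD(5) by blast
    qed
    then show "\<Union>\<C> \<in> F"
      using sub ne by (auto simp: F_def)
  qed
  then obtain M where "M \<in> F" and max: "\<And>X. X \<in> F \<Longrightarrow> M \<subseteq> X \<Longrightarrow> X = M"
    by blast
  then have M: "left_ideal M R" "I \<subseteq> M" "\<one> \<notin> M"
    by (auto simp: F_def)
  have "K = M \<or> K = carrier R" if "left_ideal K R" "M \<subseteq> K" for K
    using max[of K] that M left_ideal_eq_carrier_iff[OF that(1)] by (auto simp: F_def)
  then have "maximal_left_ideal M R"
    using M left_ideal_eq_carrier_iff[OF M(1)] by (auto simp: maximal_left_ideal_def)
  then show thesis
    using M(2) that by blast
qed

lemma (in ring) jacobson_radical_closed:
  assumes "x \<in> jacobson_radical R" "y \<in> jacobson_radical R"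
  shows "x \<oplus> y \<in> jacobson_radical R" "\<ominus> x \<in> jacobson_radical R"
  using assms left_idealD(3,4)
  unfolding jacobson_radical_def maximal_left_ideal_def by auto

text \<open>If \<open>x\<close> were outside a maximal left ideal \<open>M\<close>, then
  \<open>M\<close> together with the multiples of \<open>x\<close> would generate
  \<open>\<one>\<close>, say \<open>\<one> = y \<oplus> s \<otimes> x\<close> with \<open>y\<close>
  in \<open>M\<close>. The hypothesis at \<open>\<ominus> s\<close> gives \<open>y\<close> a left
  inverse, so \<open>M\<close> would not be proper.\<close>

lemma (in ring) jacobson_radicalI:
  assumes x: "x \<in> carrier R"
    and inv: "\<And>s. s \<in> carrier R \<Longrightarrow> \<exists>t\<in>carrier R. t \<otimes> (\<one> \<oplus> s \<otimes> x) = \<one>"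
  shows "x \<in> jacobson_radical R"
  unfolding jacobson_radical_def
proof (intro CollectI conjI allI impI)
  fix M assume "maximal_left_ideal M R"
  then have M: "left_ideal M R" "M \<noteq> carrier R"
    and max: "\<And>I. left_ideal I R \<Longrightarrow> M \<subseteq> I \<Longrightarrow> I = M \<or> I = carrier R"
    by (auto simp: maximal_left_ideal_def)
  define I where "I = {y \<oplus> z | y z. y \<in> M \<and> z \<in> {s \<otimes> x | s. s \<in> carrier R}}"
  have I: "left_ideal I R"
    unfolding I_def by (intro left_ideal_sum M left_ideal_principal x)
  have "M \<subseteq> I"
  proof
    fix y assume "y \<in> M"
    moreover from this have "y = y \<oplus> \<zero> \<otimes> x"
      using left_idealD(1)[OF M(1)] x by auto
    ultimately show "y \<in> I"
      unfolding I_def by blast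
  qed
  have "\<zero> \<oplus> \<one> \<otimes> x \<in> I"
    unfolding I_def using left_idealD(2)[OF M(1)] by blast
  then have "x \<in> I"
    using x by simp
  have "\<one> \<notin> I"
  proof
    assume "\<one> \<in> I"
    then obtain y s where ys: "y \<in> M" "s \<in> carrier R" "\<one> = y \<oplus> s \<otimes> x"
      unfolding I_def by auto
    then have yc: "y \<in> carrier R"
      using left_idealD(1)[OF M(1)] by auto
    have "y \<oplus> s \<otimes> x \<oplus> (\<ominus> s) \<otimes> x = y"
      using yc ys(2) x by (simp add: l_minus a_assoc r_neg)
    then have "\<one> \<oplus> (\<ominus> s) \<otimes> x = y"
      by (simp flip: ys(3))
    then obtain t where "t \<in> carrier R" "t \<otimes> y = \<one>"
      using inv[of "\<ominus> s"] ys by auto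
    then have "\<one> \<in> M"
      using left_idealD(5)[OF M(1), of t y] ys by simp
    then show False
      using M left_ideal_eq_carrier_iff by blast
  qed
  then have "I = M"
    using max[OF I \<open>M \<subseteq> I\<close>] by auto
  then show "x \<in> M"
    using \<open>x \<in> I\<close> by simp
qed (rule x)

text \<open>Otherwise the multiples of \<open>\<one> \<oplus> s \<otimes> x\<close> lie in a maximal
  left ideal. It also contains \<open>x\<close>, hence \<open>\<one>\<close>. Commutativity turns
  the left inverse into a two-sided one.\<close>

lemma (in cring) jacobson_radical_imp_Units:
  assumes "x \<in> jacobson_radical R" "s \<in> carrier R"
  shows "\<one> \<oplus> s \<otimes> x \<in> Units R"
proof -
  have x: "x \<in> carrier R"
    using assms by (simp add: jacobson_radical_def)
  let ?u = "\<one> \<oplus> s \<otimes> x"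
  have u: "?u \<in> carrier R"
    using x assms by simp
  have "\<one> \<in> {t \<otimes> ?u | t. t \<in> carrier R}"
  proof (rule ccontr)
    assume "\<one> \<notin> {t \<otimes> ?u | t. t \<in> carrier R}"
    then obtain M where M: "maximal_left_ideal M R" and sub: "{t \<otimes> ?u | t. t \<in> carrier R} \<subseteq> M"
      using exists_maximal_left_ideal[OF left_ideal_principal[OF u]] by blast
    have lM: "left_ideal M R" "M \<noteq> carrier R"
      using M by (auto simp: maximal_left_ideal_def)
    have "x \<in> M"
      using assms(1) M by (simp add: jacobson_radical_def)
    then have "(\<ominus> s) \<otimes> x \<in> M"
      using left_idealD(5)[OF lM(1)] assms(2) by simp
    moreover have "\<one> \<otimes> ?u \<in> M"
      using sub by blast
    ultimately have "\<one> \<otimes> ?u \<oplus> (\<ominus> s) \<otimes> x \<in> M"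
      by (rule left_idealD(3)[OF lM(1), rotated])
    then have "\<one> \<in> M"
      using x assms(2) by (simp add: l_minus a_assoc r_neg)
    then show False
      using lM left_ideal_eq_carrier_iff by blast
  qed
  then show ?thesis
    using u m_comm by (force simp: Units_def)
qed

text \<open>Surjectivity makes the preimage \<open>N\<close> of a maximal left ideal
  \<open>M\<close> maximal again: the image of a left ideal above \<open>N\<close> is a left ideal
  above \<open>M\<close>. An element of the radical lies in every such \<open>N\<close>.\<close>

lemma (in ring) jacobson_radical_surj_ring_hom:
  assumes "ring_hom_ring R S h" "h ` carrier R = carrier S" "x \<in> jacobson_radical R"
  shows "h x \<in> jacobson_radical S"
proof -
  interpret S: ring S
    using assms(1) by (simp add: ring_hom_ring_def)
  interpret h: ring_hom_ring R S h by fact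
  have x: "x \<in> carrier R"
    using assms(3) by (simp add: jacobson_radical_def)
  show ?thesis
    unfolding jacobson_radical_def
  proof (intro CollectI conjI allI impI)
    fix M assume "maximal_left_ideal M S"
    then have M: "left_ideal M S" "\<one>\<^bsub>S\<^esub> \<notin> M"
      and max: "\<And>I. left_ideal I S \<Longrightarrow> M \<subseteq> I \<Longrightarrow> I = M \<or> I = carrier S"
      using S.left_ideal_eq_carrier_iff by (auto simp: maximal_left_ideal_def)
    note MD = S.left_idealD[OF M(1)]
    define N where "N = {y \<in> carrier R. h y \<in> M}"
    have N: "left_ideal N R"
      unfolding N_def by (rule left_idealI) (use MD in auto)
    moreover have "\<one> \<notin> N"
      using M by (simp add: N_def)
    moreover have "I = N \<or> I = carrier R" if I: "left_ideal I R" and NI: "N \<subseteq> I" for I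
    proof -
      note ID = left_idealD[OF I]
      have hI: "left_ideal (h ` I) S"
      proof (rule S.left_idealI)
        show "h ` I \<subseteq> carrier S"
          using ID(1) by auto
        show "\<zero>\<^bsub>S\<^esub> \<in> h ` I"
          using imageI[OF ID(2), of h] by simp
        fix u v assume "u \<in> h ` I" "v \<in> h ` I"
        then obtain a b where "a \<in> I" "b \<in> I" "u = h a" "v = h b" by auto
        then show "u \<oplus>\<^bsub>S\<^esub> v \<in> h ` I"
          using imageI[OF ID(3), of a b h] subsetD[OF ID(1)] by simp
      next
        fix s u assume "s \<in> carrier S" "u \<in> h ` I"
        then obtain a b where "a \<in> carrier R" "b \<in> I" "s = h a" "u = h b"
          using assms(2) by (metis imageE)
        then show "s \<otimes>\<^bsub>S\<^esub> u \<in> h ` I"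
          using imageI[OF ID(5), of a b h] subsetD[OF ID(1)] by simp
      qed
      have "M \<subseteq> h ` I"
      proof
        fix m assume m: "m \<in> M"
        then obtain y where "y \<in> carrier R" "m = h y"
          using MD(1) assms(2) by blast
        then show "m \<in> h ` I"
          using m NI by (auto simp: N_def)
      qed
      then consider "h ` I = M" | "h ` I = carrier S"
        using max[OF hI] by auto
      then show ?thesis
      proof cases
        case 1
        then have "I \<subseteq> N"
          using ID(1) by (auto simp: N_def)
        then show ?thesis
          using NI by auto
      next
        case 2
        then obtain y where y: "y \<in> I" "h y = \<one>\<^bsub>S\<^esub>"
          using S.one_closed by (metis imageE)
        then have yc: "y \<in> carrier R"
          using ID(1) by auto
        \<comment> \<open>\<open>N\<close> contains the kernel of \<open>h\<close>, so
          \<open>I\<close> contains \<open>\<one> \<oplus> \<ominus> y\<close> as well as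
          \<open>y\<close>, and therefore \<open>\<one>\<close>.\<close>
        then have "h (\<one> \<oplus> \<ominus> y) = \<zero>\<^bsub>S\<^esub>"
          using y by (simp add: S.r_neg)
        then have "\<one> \<oplus> \<ominus> y \<in> I"
          using NI MD(2) yc by (auto simp: N_def)
        then have "(\<one> \<oplus> \<ominus> y) \<oplus> y \<in> I"
          using ID(3) y by blast
        then have "\<one> \<in> I"
          using yc by (simp add: a_assoc l_neg)
        then show ?thesis
          using left_ideal_eq_carrier_iff[OF I] by simp
      qed
    qed
    ultimately have "maximal_left_ideal N R"
      using left_ideal_eq_carrier_iff[OF N] by (simp add: maximal_left_ideal_def)
    then have "x \<in> N"
      using assms(3) by (simp add: jacobson_radical_def)
    then show "h x \<in> M"
      by (simp add: N_def)
  qed (use x in simp)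
qed

section \<open>Comaximal elements and idempotents\<close>

definition (in ring) comaximal :: "'a \<Rightarrow> 'a \<Rightarrow> bool" where
  "comaximal p q \<longleftrightarrow> (\<exists>u\<in>carrier R. \<exists>v\<in>carrier R. u \<otimes> p \<oplus> v \<otimes> q = \<one>)"

lemma (in cring) comaximal_sym:
  assumes "p \<in> carrier R" "q \<in> carrier R" "comaximal p q"
  shows "comaximal q p"
proof -
  obtain u v where "u \<in> carrier R" "v \<in> carrier R" "u \<otimes> p \<oplus> v \<otimes> q = \<one>"
    using assms(3) by (auto simp: comaximal_def)
  then show ?thesis
    unfolding comaximal_def using assms(1,2)
    by (intro bexI[of _ v] bexI[of _ u]) (simp_all add: a_comm)
qed

text \<open>Multiply the two Bezout identities: every term except
  \<open>u \<otimes> u' \<otimes> p \<otimes> p'\<close> has a factor \<open>q\<close>.\<close>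

lemma (in cring) comaximal_mult:
  assumes c: "p \<in> carrier R" "p' \<in> carrier R" "q \<in> carrier R"
    and "comaximal p q" "comaximal p' q"
  shows "comaximal (p \<otimes> p') q"
proof -
  obtain u v u' v' where uv: "u \<in> carrier R" "v \<in> carrier R" "u' \<in> carrier R" "v' \<in> carrier R"
    and eq: "u \<otimes> p \<oplus> v \<otimes> q = \<one>" "u' \<otimes> p' \<oplus> v' \<otimes> q = \<one>"
    using assms(4,5) by (auto simp: comaximal_def)
  have "(u \<otimes> u') \<otimes> (p \<otimes> p') \<oplus> (u \<otimes> p \<otimes> v' \<oplus> v \<otimes> u' \<otimes> p' \<oplus> v \<otimes> v' \<otimes> q) \<otimes> q =
      (u \<otimes> p \<oplus> v \<otimes> q) \<otimes> (u' \<otimes> p' \<oplus> v' \<otimes> q)"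
    using uv c by algebra
  also have "\<dots> = \<one>"
    by (simp add: eq)
  finally show ?thesis
    using uv c unfolding comaximal_def
    by (intro bexI[of _ "u \<otimes> u'"] bexI[of _ "u \<otimes> p \<otimes> v' \<oplus> v \<otimes> u' \<otimes> p' \<oplus> v \<otimes> v' \<otimes> q"]) auto
qed

lemma (in cring) comaximal_finprod:
  assumes "finite A" "q \<in> carrier R"
    and "\<And>i. i \<in> A \<Longrightarrow> p i \<in> carrier R" "\<And>i. i \<in> A \<Longrightarrow> comaximal (p i) q"
  shows "comaximal (finprod R p A) q"
  using assms(1,3,4)
proof (induction A)
  case empty
  show ?case
    unfolding comaximal_def using assms(2) by (intro bexI[of _ \<one>] bexI[of _ \<zero>]) auto
next
  case (insert a A)
  then have "p \<in> A \<rightarrow> carrier R" by auto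
  with insert show ?case
    by (simp add: comaximal_mult assms(2))
qed

text \<open>The ring splits along \<open>e\<close>, \<open>f \<otimes> f'\<close> and
  \<open>f \<otimes> e'\<close>. On the first component the left element is \<open>\<one>\<close>,
  on the second the right one is \<open>\<one>\<close>. On the third they are
  \<open>y \<oplus> d\<close> and \<open>y\<close>, whose difference \<open>d\<close> is invertible
  there by \<open>z\<close>.\<close>

lemma (in cring) comaximal_idempotent_combination:
  assumes c: "e \<in> carrier R" "f \<in> carrier R" "e' \<in> carrier R" "f' \<in> carrier R"
      "y \<in> carrier R" "d \<in> carrier R" "z \<in> carrier R"
    and e: "e \<otimes> e = e" "e \<otimes> f = \<zero>" "f \<otimes> f = f" "e \<oplus> f = \<one>"
    and e': "e' \<otimes> e' = e'" "e' \<otimes> f' = \<zero>" "f' \<otimes> f' = f'" "e' \<oplus> f' = \<one>"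
    and z: "f \<otimes> e' \<otimes> z \<otimes> d = f \<otimes> e'"
  shows "comaximal (e \<oplus> f \<otimes> (y \<oplus> d)) (f' \<oplus> e' \<otimes> y)"
proof -
  \<comment> \<open>The inverse of \<open>d\<close> on the component \<open>f \<otimes> e'\<close>,
    extended by zero to the other two.\<close>
  define s where "s = f \<otimes> e' \<otimes> z"
  have s: "s \<in> carrier R"
    using c by (simp add: s_def)
  have "s \<otimes> e = e' \<otimes> z \<otimes> (e \<otimes> f)" "s \<otimes> f = (f \<otimes> f) \<otimes> e' \<otimes> z"
    "s \<otimes> e' = f \<otimes> (e' \<otimes> e') \<otimes> z" "s \<otimes> f' = f \<otimes> z \<otimes> (e' \<otimes> f')"
    unfolding s_def using c by (simp_all add: m_ac)
  then have se: "s \<otimes> e = \<zero>" "s \<otimes> f = s" "s \<otimes> e' = s" "s \<otimes> f' = \<zero>"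
    using c by (simp_all add: e e' s_def)
  have 1: "e \<otimes> (e \<oplus> f \<otimes> (y \<oplus> d)) = e"
    using c by (simp add: r_distr e m_assoc[symmetric])
  have 2: "s \<otimes> (e \<oplus> f \<otimes> (y \<oplus> d)) = s \<otimes> y \<oplus> f \<otimes> e'"
    using c s z by (simp add: r_distr m_assoc[symmetric] se) (simp add: s_def)
  have 3: "f \<otimes> f' \<otimes> (f' \<oplus> e' \<otimes> y) = f \<otimes> f'"
  proof -
    have "f \<otimes> f' \<otimes> (f' \<oplus> e' \<otimes> y) = f \<otimes> (f' \<otimes> f') \<oplus> f \<otimes> (e' \<otimes> f') \<otimes> y"
      using c by (simp add: r_distr m_ac)
    then show ?thesis
      using c by (simp add: e')
  qed
  have 4: "s \<otimes> (f' \<oplus> e' \<otimes> y) = s \<otimes> y"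
    using c s by (simp add: r_distr m_assoc[symmetric] se)
  \<comment> \<open>The Bezout coefficients are glued from the three components; on the third,
    \<open>s\<close> and \<open>\<ominus> s\<close> scale the difference of the two elements to
    \<open>\<one>\<close>.\<close>
  have "(e \<oplus> s) \<otimes> (e \<oplus> f \<otimes> (y \<oplus> d)) \<oplus> (f \<otimes> f' \<oplus> \<ominus> s) \<otimes> (f' \<oplus> e' \<otimes> y)
      = e \<oplus> (s \<otimes> y \<oplus> f \<otimes> e') \<oplus> (f \<otimes> f' \<oplus> \<ominus> (s \<otimes> y))"
    using c s by (simp only: l_distr l_minus 1 2 3 4 a_closed m_closed a_inv_closed)
  also have "\<dots> = e \<oplus> f \<otimes> (e' \<oplus> f')"
    using c s by algebra
  also have "\<dots> = \<one>"
    using c e(4) e'(4) by simp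
  finally show ?thesis
    using c s unfolding comaximal_def
    by (intro bexI[of _ "e \<oplus> s"] bexI[of _ "f \<otimes> f' \<oplus> \<ominus> s"]) auto
qed

section \<open>Elements annihilated by a product of linear factors\<close>

lemma (in ring_hom_cring) Units_of_annihilated:
  assumes x: "x \<in> carrier S"
    and "finite I" "\<And>i. i \<in> I \<Longrightarrow> d i \<in> Units R"
    and zero: "(\<Otimes>\<^bsub>S\<^esub>i\<in>I. x \<oplus>\<^bsub>S\<^esub> h (\<ominus> d i)) = \<zero>\<^bsub>S\<^esub>"
  shows "x \<in> Units S"
proof -
  have "S.comaximal (\<Otimes>\<^bsub>S\<^esub>i\<in>I. x \<oplus>\<^bsub>S\<^esub> h (\<ominus> d i)) x"
  proof (rule S.comaximal_finprod)
    fix i assume "i \<in> I"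
    then have u: "d i \<in> Units R" by (rule assms)
    then have d: "d i \<in> carrier R" "inv (d i) \<in> carrier R" by auto
    then show "x \<oplus>\<^bsub>S\<^esub> h (\<ominus> d i) \<in> carrier S"
      using x by simp
    have "(\<ominus>\<^bsub>S\<^esub> h (inv d i)) \<otimes>\<^bsub>S\<^esub> (x \<oplus>\<^bsub>S\<^esub> (\<ominus>\<^bsub>S\<^esub> h (d i))) \<oplus>\<^bsub>S\<^esub> h (inv d i) \<otimes>\<^bsub>S\<^esub> x
        = h (inv d i) \<otimes>\<^bsub>S\<^esub> h (d i)"
      using d[THEN hom_closed] x by algebra
    also have "\<dots> = \<one>\<^bsub>S\<^esub>"
      using d u by (simp flip: hom_mult)
    finally show "S.comaximal (x \<oplus>\<^bsub>S\<^esub> h (\<ominus> d i)) x"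
      unfolding S.comaximal_def using d x
      by (intro bexI[of _ "\<ominus>\<^bsub>S\<^esub> h (inv d i)"] bexI[of _ "h (inv d i)"]) auto
  qed (use assms in auto)
  then obtain v where "v \<in> carrier S" "v \<otimes>\<^bsub>S\<^esub> x = \<one>\<^bsub>S\<^esub>"
    unfolding zero S.comaximal_def using x by auto
  then show ?thesis
    using x S.m_comm by (auto simp: Units_def)
qed

text \<open>The last clause keeps matrices out of the argument: \<open>g\<close> stands for any
  retraction of \<open>h\<close> that evaluates \<open>x\<close> at \<open>a i\<close>, as the
  \<open>i\<close>-th diagonal entry does. One \<open>E\<close> serves all \<open>g\<close> and
  \<open>i\<close>, since such a \<open>g\<close> sends \<open>p i\<close> to \<open>e i\<close> and
  \<open>q i\<close> to \<open>f i\<close>.\<close>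

lemma (in ring_hom_cring) exists_idempotent_of_annihilated:
  assumes x: "x \<in> carrier S" and fin: "finite I"
    and a: "\<And>i. i \<in> I \<Longrightarrow> a i \<in> carrier R"
    and e: "\<And>i. i \<in> I \<Longrightarrow> e i \<in> carrier R" "\<And>i. i \<in> I \<Longrightarrow> e i \<otimes> e i = e i"
    and J: "\<And>i. i \<in> I \<Longrightarrow> a i \<ominus> e i \<in> jacobson_radical R"
    and zero: "(\<Otimes>\<^bsub>S\<^esub>i\<in>I. x \<oplus>\<^bsub>S\<^esub> h (\<ominus> a i)) = \<zero>\<^bsub>S\<^esub>"
  shows "\<exists>E\<in>carrier S. E \<otimes>\<^bsub>S\<^esub> E = E \<and>
    (\<forall>g i. i \<in> I \<longrightarrow> ring_hom_cring S R g \<longrightarrow> (\<forall>r\<in>carrier R. g (h r) = r) \<longrightarrow> g x = a i \<longrightarrow> g E = e i)"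
proof -
  define f where "f i = \<one> \<ominus> e i" for i
  have f: "f i \<in> carrier R" "e i \<otimes> f i = \<zero>" "f i \<otimes> f i = f i" "e i \<oplus> f i = \<one>" if "i \<in> I" for i
  proof -
    note c = e(1)[OF that]
    show "f i \<in> carrier R" using c by (simp add: f_def)
    have "e i \<otimes> (\<one> \<ominus> e i) = e i \<ominus> e i \<otimes> e i"
      using c by algebra
    also have "\<dots> = \<zero>"
      using c e(2)[OF that] by (simp add: R.minus_eq R.r_neg)
    finally show ef: "e i \<otimes> f i = \<zero>"
      by (simp add: f_def)
    have "(\<one> \<ominus> e i) \<otimes> f i = f i \<ominus> e i \<otimes> f i"
      using c \<open>f i \<in> carrier R\<close> by algebra
    also have "\<dots> = f i"
      using ef \<open>f i \<in> carrier R\<close> by (simp add: R.minus_eq)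
    finally show "f i \<otimes> f i = f i"
      by (simp only: f_def)
    show "e i \<oplus> f i = \<one>"
      unfolding f_def using c by algebra
  qed
  define y where "y i = x \<oplus>\<^bsub>S\<^esub> h (\<ominus> a i)" for i
  define p where "p i = h (e i) \<oplus>\<^bsub>S\<^esub> h (f i) \<otimes>\<^bsub>S\<^esub> y i" for i
  define q where "q i = h (f i) \<oplus>\<^bsub>S\<^esub> h (e i) \<otimes>\<^bsub>S\<^esub> y i" for i
  define P where "P = finprod S p I"
  define Q where "Q = finprod S q I"
  have yc: "y i \<in> carrier S" if "i \<in> I" for i
    using that a x by (simp add: y_def)
  have pc: "p i \<in> carrier S" and qc: "q i \<in> carrier S" if "i \<in> I" for i
    using that f e yc by (auto simp: p_def q_def)
  have hE: "h (e i) \<otimes>\<^bsub>S\<^esub> h (e i) = h (e i)" "h (e i) \<otimes>\<^bsub>S\<^esub> h (f i) = \<zero>\<^bsub>S\<^esub>"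
    "h (f i) \<otimes>\<^bsub>S\<^esub> h (f i) = h (f i)" "h (e i) \<oplus>\<^bsub>S\<^esub> h (f i) = \<one>\<^bsub>S\<^esub>" if "i \<in> I" for i
    using that e f by (simp_all flip: hom_mult hom_add)
  have PQc: "P \<in> carrier S" "Q \<in> carrier S"
    using pc qc by (auto simp: P_def Q_def intro!: S.finprod_closed)
  have "p i \<otimes>\<^bsub>S\<^esub> q i = y i" if "i \<in> I" for i
  proof -
    have "p i \<otimes>\<^bsub>S\<^esub> q i = h (e i) \<otimes>\<^bsub>S\<^esub> h (f i) \<oplus>\<^bsub>S\<^esub>
        (h (e i) \<otimes>\<^bsub>S\<^esub> h (e i) \<oplus>\<^bsub>S\<^esub> h (f i) \<otimes>\<^bsub>S\<^esub> h (f i)) \<otimes>\<^bsub>S\<^esub> y i \<oplus>\<^bsub>S\<^esub>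
        (h (e i) \<otimes>\<^bsub>S\<^esub> h (f i)) \<otimes>\<^bsub>S\<^esub> y i \<otimes>\<^bsub>S\<^esub> y i"
      unfolding p_def q_def using yc[OF that] hom_closed[OF e(1)[OF that]] hom_closed[OF f(1)[OF that]]
      by algebra
    then show ?thesis
      using yc[OF that] by (simp add: hE[OF that])
  qed
  then have "(\<Otimes>\<^bsub>S\<^esub>i\<in>I. p i \<otimes>\<^bsub>S\<^esub> q i) = (\<Otimes>\<^bsub>S\<^esub>i\<in>I. y i)"
    using yc by (intro S.finprod_cong') auto
  then have "P \<otimes>\<^bsub>S\<^esub> Q = (\<Otimes>\<^bsub>S\<^esub>i\<in>I. y i)"
    unfolding P_def Q_def using pc qc by (subst (asm) S.finprod_multf) auto
  then have PQ: "P \<otimes>\<^bsub>S\<^esub> Q = \<zero>\<^bsub>S\<^esub>"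
    using zero by (simp add: y_def)
  have "S.comaximal (p i) (q j)" if ij: "i \<in> I" "j \<in> I" for i j
  proof -
    \<comment> \<open>Thus \<open>a j \<ominus> a i\<close> is \<open>e j \<ominus> e i\<close> plus
      the radical element \<open>w\<close>. Multiplying by \<open>f i \<otimes> e j\<close> kills
      \<open>e i\<close> and absorbs \<open>e j\<close>, which leaves
      \<open>f i \<otimes> e j \<otimes> (\<one> \<oplus> w)\<close>, so inverting
      \<open>\<one> \<oplus> w\<close> gives the required \<open>z\<close>.\<close>
    define w where "w = (a j \<ominus> e j) \<oplus> \<ominus> (a i \<ominus> e i)"
    have "w \<in> jacobson_radical R"
      unfolding w_def using J ij by (intro R.jacobson_radical_closed) auto
    then have wu: "\<one> \<oplus> w \<in> Units R"
      using R.jacobson_radical_imp_Units[of w \<one>] by (simp add: jacobson_radical_def)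
    define z where "z = inv (\<one> \<oplus> w)"
    note c = e(1)[OF ij(1)] e(1)[OF ij(2)] f(1)[OF ij(1)] f(1)[OF ij(2)] a[OF ij(1)] a[OF ij(2)]
    have wc: "w \<in> carrier R" "z \<in> carrier R" and wz: "(\<one> \<oplus> w) \<otimes> z = \<one>"
      using c wu by (auto simp: w_def z_def)
    have "f i \<otimes> e j \<otimes> z \<otimes> (a j \<ominus> a i) =
        (f i \<otimes> (e j \<otimes> e j) \<oplus> \<ominus> ((e i \<otimes> f i) \<otimes> e j) \<oplus> f i \<otimes> e j \<otimes> w) \<otimes> z"
      unfolding w_def using c wc(2) by algebra
    also have "\<dots> = f i \<otimes> e j \<otimes> ((\<one> \<oplus> w) \<otimes> z)"
      unfolding e(2)[OF ij(2)] f(2)[OF ij(1)] using c wc by algebra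
    also have "\<dots> = f i \<otimes> e j"
      using c by (simp add: wz)
    finally have "h (f i \<otimes> e j \<otimes> z \<otimes> (a j \<ominus> a i)) = h (f i \<otimes> e j)"
      by (rule arg_cong)
    then have "h (f i) \<otimes>\<^bsub>S\<^esub> h (e j) \<otimes>\<^bsub>S\<^esub> h z \<otimes>\<^bsub>S\<^esub> h (a j \<ominus> a i) = h (f i) \<otimes>\<^bsub>S\<^esub> h (e j)"
      using c wc by simp
    then have "S.comaximal (h (e i) \<oplus>\<^bsub>S\<^esub> h (f i) \<otimes>\<^bsub>S\<^esub> (y j \<oplus>\<^bsub>S\<^esub> h (a j \<ominus> a i))) (h (f j) \<oplus>\<^bsub>S\<^esub> h (e j) \<otimes>\<^bsub>S\<^esub> y j)"
      using c wc ij hE yc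
      by (intro S.comaximal_idempotent_combination[where z = "h z"]) auto
    moreover have "y j \<oplus>\<^bsub>S\<^esub> h (a j \<ominus> a i) = y i"
    proof -
      have "y j \<oplus>\<^bsub>S\<^esub> h (a j \<ominus> a i) = x \<oplus>\<^bsub>S\<^esub> h (\<ominus> a j \<oplus> (a j \<ominus> a i))"
        unfolding y_def using c x by (simp add: S.a_assoc)
      also have "\<ominus> a j \<oplus> (a j \<ominus> a i) = \<ominus> a i"
        using c by algebra
      finally show ?thesis
        by (simp add: y_def)
    qed
    ultimately show ?thesis
      by (simp add: p_def q_def)
  qed
  \<comment> \<open>Comaximality passes to products one argument at a time: first over the
    \<open>p i\<close> for a fixed \<open>q j\<close>, then, with the roles exchanged, over the
    \<open>q j\<close>.\<close>
  then have "S.comaximal P (q j)" if "j \<in> I" for j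
    unfolding P_def using fin pc qc that by (intro S.comaximal_finprod) auto
  then have "S.comaximal Q P"
    unfolding Q_def using fin pc qc PQc by (intro S.comaximal_finprod S.comaximal_sym[of P]) auto
  then obtain u v where uv: "u \<in> carrier S" "v \<in> carrier S" "v \<otimes>\<^bsub>S\<^esub> Q \<oplus>\<^bsub>S\<^esub> u \<otimes>\<^bsub>S\<^esub> P = \<one>\<^bsub>S\<^esub>"
    by (auto simp: S.comaximal_def)
  define E where "E = u \<otimes>\<^bsub>S\<^esub> P"
  have Ec: "E \<in> carrier S"
    using uv PQc by (simp add: E_def)
  have "E = (v \<otimes>\<^bsub>S\<^esub> Q \<oplus>\<^bsub>S\<^esub> E) \<otimes>\<^bsub>S\<^esub> E"
    using uv Ec by (simp add: E_def)
  also have "\<dots> = u \<otimes>\<^bsub>S\<^esub> v \<otimes>\<^bsub>S\<^esub> (P \<otimes>\<^bsub>S\<^esub> Q) \<oplus>\<^bsub>S\<^esub> E \<otimes>\<^bsub>S\<^esub> E"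
    unfolding E_def using uv(1,2) PQc by algebra
  also have "\<dots> = E \<otimes>\<^bsub>S\<^esub> E"
    using uv(1,2) Ec by (simp add: PQ)
  finally have EE: "E \<otimes>\<^bsub>S\<^esub> E = E" by simp
  have "g E = e i"
    if i: "i \<in> I" and "ring_hom_cring S R g" and gh: "\<forall>r\<in>carrier R. g (h r) = r" and gx: "g x = a i" for g i
  proof -
    interpret g: ring_hom_cring S R g by fact
    note c = e(1)[OF i] f(1)[OF i] a[OF i]
    have I: "I = insert i (I - {i})" using i by auto
    have gy: "g (y i) = \<zero>"
      using c x gh by (simp add: y_def gx R.r_neg)
    \<comment> \<open>Only the \<open>i\<close>-th factors of \<open>P\<close> and \<open>Q\<close>
      have known images under \<open>g\<close>. Splitting them off shows that \<open>g P\<close> is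
      a multiple of \<open>e i\<close> and \<open>g Q\<close> a multiple of
      \<open>f i\<close>.\<close>
    have "\<exists>r\<in>carrier S. P = p i \<otimes>\<^bsub>S\<^esub> r"
      unfolding P_def using pc i fin
      by (subst I, subst S.finprod_insert) (auto intro!: bexI[of _ "finprod S p (I - {i})"])
    then obtain r where r: "r \<in> carrier S" "P = p i \<otimes>\<^bsub>S\<^esub> r" by blast
    have "\<exists>r\<in>carrier S. Q = q i \<otimes>\<^bsub>S\<^esub> r"
      unfolding Q_def using qc i fin
      by (subst I, subst S.finprod_insert) (auto intro!: bexI[of _ "finprod S q (I - {i})"])
    then obtain s where s: "s \<in> carrier S" "Q = q i \<otimes>\<^bsub>S\<^esub> s" by blast
    have gP: "g P = e i \<otimes> g r" and gQ: "g Q = f i \<otimes> g s"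
      using r s pc[OF i] qc[OF i] c yc[OF i] gh gy by (simp_all add: p_def q_def)
    have "g (v \<otimes>\<^bsub>S\<^esub> Q \<oplus>\<^bsub>S\<^esub> u \<otimes>\<^bsub>S\<^esub> P) = \<one>"
      by (simp add: uv(3))
    then have one: "g v \<otimes> (f i \<otimes> g s) \<oplus> g u \<otimes> (e i \<otimes> g r) = \<one>"
      using uv(1,2) PQc by (simp add: gP gQ)
    note c' = c(1,2) g.hom_closed[OF uv(1)] g.hom_closed[OF uv(2)] g.hom_closed[OF r(1)] g.hom_closed[OF s(1)]
    \<comment> \<open>Multiplying the image of the Bezout identity by \<open>e i\<close> removes the
      \<open>Q\<close> part and leaves the \<open>P\<close> part, which is \<open>g E\<close>,
      unchanged.\<close>
    have "e i = e i \<otimes> (g v \<otimes> (f i \<otimes> g s) \<oplus> g u \<otimes> (e i \<otimes> g r))"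
      using c by (simp add: one)
    also have "\<dots> = g v \<otimes> (e i \<otimes> f i) \<otimes> g s \<oplus> g u \<otimes> (e i \<otimes> e i) \<otimes> g r"
      using c' by algebra
    also have "\<dots> = g u \<otimes> (e i \<otimes> g r)"
      using c' e(2)[OF i] f(2)[OF i] by (simp add: R.m_assoc)
    also have "\<dots> = g E"
      unfolding E_def using uv PQc by (simp add: gP)
    finally show ?thesis by simp
  qed
  then show ?thesis
    using Ec EE by blast
qed

section \<open>Double commutants and triangular matrices\<close>

lemma ring_comm2D:
  assumes "x \<in> ring_comm2 S a"
  shows "x \<in> carrier S" "y \<in> carrier S \<Longrightarrow> y \<otimes>\<^bsub>S\<^esub> a = a \<otimes>\<^bsub>S\<^esub> y \<Longrightarrow> x \<otimes>\<^bsub>S\<^esub> y = y \<otimes>\<^bsub>S\<^esub> x"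
  using assms by (auto simp: ring_comm2_def ring_comm_def)

lemma ring_comm2I:
  assumes "x \<in> carrier S"
    and "\<And>y. y \<in> carrier S \<Longrightarrow> y \<otimes>\<^bsub>S\<^esub> a = a \<otimes>\<^bsub>S\<^esub> y \<Longrightarrow> x \<otimes>\<^bsub>S\<^esub> y = y \<otimes>\<^bsub>S\<^esub> x"
  shows "x \<in> ring_comm2 S a"
  using assms unfolding ring_comm2_def ring_comm_def by blast

text \<open>Passing to the double commutant supplies a commutative ring around \<open>a\<close>
  inside a noncommutative one, where finite products and Bezout arguments are available.\<close>

lemma (in ring) cring_ring_comm2:
  assumes a: "a \<in> carrier R"
  shows "cring (R\<lparr>carrier := ring_comm2 R a\<rparr>)"
proof -
  have "subring (ring_comm2 R a) R"
  proof (rule subringI)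
    show "ring_comm2 R a \<subseteq> carrier R"
      by (auto simp: ring_comm2_def)
    show "\<one> \<in> ring_comm2 R a"
      by (rule ring_comm2I) auto
    fix x assume x: "x \<in> ring_comm2 R a"
    note xD = ring_comm2D[OF x]
    show "\<ominus> x \<in> ring_comm2 R a"
    proof (rule ring_comm2I)
      fix z assume z: "z \<in> carrier R" "z \<otimes> a = a \<otimes> z"
      then show "\<ominus> x \<otimes> z = z \<otimes> \<ominus> x"
        using xD(1) by (simp add: l_minus r_minus xD(2)[OF z])
    qed (use xD in simp)
    fix y assume y: "y \<in> ring_comm2 R a"
    note yD = ring_comm2D[OF y]
    show "x \<otimes> y \<in> ring_comm2 R a"
    proof (rule ring_comm2I)
      fix z assume z: "z \<in> carrier R" "z \<otimes> a = a \<otimes> z"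
      have "x \<otimes> y \<otimes> z = x \<otimes> z \<otimes> y"
        using xD(1) yD(1) z(1) by (simp add: m_assoc yD(2)[OF z])
      then show "x \<otimes> y \<otimes> z = z \<otimes> (x \<otimes> y)"
        using xD(1) yD(1) z(1) by (simp add: m_assoc xD(2)[OF z])
    qed (use xD yD in simp)
    show "x \<oplus> y \<in> ring_comm2 R a"
    proof (rule ring_comm2I)
      fix z assume z: "z \<in> carrier R" "z \<otimes> a = a \<otimes> z"
      then show "(x \<oplus> y) \<otimes> z = z \<otimes> (x \<oplus> y)"
        using xD(1) yD(1) by (simp add: l_distr r_distr xD(2)[OF z] yD(2)[OF z])
    qed (use xD yD in simp)
  qed
  \<comment> \<open>As \<open>a\<close> commutes with itself, \<open>y\<close> commutes with
    \<open>a\<close>. So \<open>y\<close> is in the commutant of \<open>a\<close>, with which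
    \<open>x\<close> commutes.\<close>
  moreover have "x \<otimes> y = y \<otimes> x" if x: "x \<in> ring_comm2 R a" and y: "y \<in> ring_comm2 R a" for x y
    using ring_comm2D(2)[OF x ring_comm2D(1)[OF y]] ring_comm2D(2)[OF y a] by simp
  ultimately have "subcring (ring_comm2 R a) R"
    by (rule subcringI)
  then show ?thesis
    using subcring_iff[of "ring_comm2 R a"] by (simp add: ring_comm2_def)
qed

section \<open>Scalar matrices and diagonal entries\<close>

definition scalar_mat :: "nat \<Rightarrow> ('a, 'm) ring_scheme \<Rightarrow> 'a \<Rightarrow> 'a mat" where
  "scalar_mat n R r = mat n n (\<lambda>(i, j). if i = j then r else \<zero>\<^bsub>R\<^esub>)"

lemma upper_triangular_ring_carrierD:
  assumes "A \<in> carrier (upper_triangular_ring n R)"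
  shows "i < n \<Longrightarrow> j < n \<Longrightarrow> A $$ (i, j) \<in> carrier R"
    and "i < n \<Longrightarrow> j < i \<Longrightarrow> A $$ (i, j) = \<zero>\<^bsub>R\<^esub>"
    and "dim_row A = n" "dim_col A = n"
  using assms by (auto simp: upper_triangular_ring_def)

lemma upper_triangular_ring_index:
  assumes "i < n" "j < n"
  shows "(A \<oplus>\<^bsub>upper_triangular_ring n R\<^esub> B) $$ (i, j) = A $$ (i, j) \<oplus>\<^bsub>R\<^esub> B $$ (i, j)"
    and "(A \<otimes>\<^bsub>upper_triangular_ring n R\<^esub> B) $$ (i, j) = (\<Oplus>\<^bsub>R\<^esub>k\<in>{..<n}. A $$ (i, k) \<otimes>\<^bsub>R\<^esub> B $$ (k, j))"
    and "\<zero>\<^bsub>upper_triangular_ring n R\<^esub> $$ (i, j) = \<zero>\<^bsub>R\<^esub>"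
    and "\<one>\<^bsub>upper_triangular_ring n R\<^esub> $$ (i, j) = (if i = j then \<one>\<^bsub>R\<^esub> else \<zero>\<^bsub>R\<^esub>)"
    and "scalar_mat n R r $$ (i, j) = (if i = j then r else \<zero>\<^bsub>R\<^esub>)"
  using assms by (auto simp: upper_triangular_ring_def scalar_mat_def)

lemma upper_triangular_ring_eqI:
  assumes "A \<in> carrier (upper_triangular_ring n R)" "B \<in> carrier (upper_triangular_ring n R)"
    and "\<And>i j. i < n \<Longrightarrow> j < n \<Longrightarrow> A $$ (i, j) = B $$ (i, j)"
  shows "A = B"
  using assms(3) upper_triangular_ring_carrierD(3,4)[OF assms(1)]
    upper_triangular_ring_carrierD(3,4)[OF assms(2)]
  by (intro eq_matI) auto

lemma (in ring) scalar_mat_closed: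
  "r \<in> carrier R \<Longrightarrow> scalar_mat n R r \<in> carrier (upper_triangular_ring n R)"
  by (auto simp: upper_triangular_ring_def scalar_mat_def)

lemma (in ring) finsum_eq_single:
  assumes "finite I" "i \<in> I" "f i \<in> carrier R" "\<And>k. k \<in> I \<Longrightarrow> k \<noteq> i \<Longrightarrow> f k = \<zero>"
  shows "(\<Oplus>k\<in>I. f k) = f i"
proof -
  have "(\<Oplus>k\<in>I. f k) = (\<Oplus>k\<in>I. if i = k then f i else \<zero>)"
    using assms(3,4) by (intro finsum_cong') auto
  then show ?thesis
    using finsum_singleton[of i I "\<lambda>_. f i"] assms by simp
qed

text \<open>For \<open>k \<noteq> i\<close> one of the entries at \<open>(i, k)\<close> and
  \<open>(k, i)\<close> lies below the diagonal, so a single term of the sum survives.\<close>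

lemma (in ring) upper_triangular_diag_mult:
  assumes A: "A \<in> carrier (upper_triangular_ring n R)" and B: "B \<in> carrier (upper_triangular_ring n R)"
    and i: "i < n"
  shows "(A \<otimes>\<^bsub>upper_triangular_ring n R\<^esub> B) $$ (i, i) = A $$ (i, i) \<otimes> B $$ (i, i)"
proof -
  note AD = upper_triangular_ring_carrierD[OF A] and BD = upper_triangular_ring_carrierD[OF B]
  have "A $$ (i, k) \<otimes> B $$ (k, i) = \<zero>" if "k < n" "k \<noteq> i" for k
    using that i AD(1)[of i k] BD(1)[of k i] AD(2)[of i k] BD(2)[of k i] by (cases "k < i") auto
  then show ?thesis
    using i AD(1) BD(1) by (auto simp: upper_triangular_ring_index intro!: finsum_eq_single)
qed

lemma (in ring) scalar_mat_mult_index: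
  assumes A: "A \<in> carrier (upper_triangular_ring n R)" and r: "r \<in> carrier R" and ij: "i < n" "j < n"
  shows "(scalar_mat n R r \<otimes>\<^bsub>upper_triangular_ring n R\<^esub> A) $$ (i, j) = r \<otimes> A $$ (i, j)"
    and "(A \<otimes>\<^bsub>upper_triangular_ring n R\<^esub> scalar_mat n R r) $$ (i, j) = A $$ (i, j) \<otimes> r"
proof -
  note AD = upper_triangular_ring_carrierD(1)[OF A]
  have "(\<Oplus>k\<in>{..<n}. scalar_mat n R r $$ (i, k) \<otimes> A $$ (k, j)) = scalar_mat n R r $$ (i, i) \<otimes> A $$ (i, j)"
    using ij r AD by (intro finsum_eq_single) (auto simp: upper_triangular_ring_index)
  then show "(scalar_mat n R r \<otimes>\<^bsub>upper_triangular_ring n R\<^esub> A) $$ (i, j) = r \<otimes> A $$ (i, j)"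
    using ij by (simp add: upper_triangular_ring_index)
  have "(\<Oplus>k\<in>{..<n}. A $$ (i, k) \<otimes> scalar_mat n R r $$ (k, j)) = A $$ (i, j) \<otimes> scalar_mat n R r $$ (j, j)"
    using ij r AD by (intro finsum_eq_single) (auto simp: upper_triangular_ring_index)
  then show "(A \<otimes>\<^bsub>upper_triangular_ring n R\<^esub> scalar_mat n R r) $$ (i, j) = A $$ (i, j) \<otimes> r"
    using ij by (simp add: upper_triangular_ring_index)
qed

text \<open>Over a commutative ring scalar matrices are central, hence in every double
  commutant.\<close>

lemma (in cring) scalar_mat_ring_comm2:
  assumes "A \<in> carrier (upper_triangular_ring n R)" "r \<in> carrier R"
  shows "scalar_mat n R r \<in> ring_comm2 (upper_triangular_ring n R) A"
proof (rule ring_comm2I)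
  interpret T: ring "upper_triangular_ring n R"
    by (rule ring_upper_triangular_ring)
  fix B assume B: "B \<in> carrier (upper_triangular_ring n R)"
  then show "scalar_mat n R r \<otimes>\<^bsub>upper_triangular_ring n R\<^esub> B = B \<otimes>\<^bsub>upper_triangular_ring n R\<^esub> scalar_mat n R r"
    using assms(2)
    by (intro upper_triangular_ring_eqI[where n = n and R = R])
       (auto simp: scalar_mat_closed scalar_mat_mult_index upper_triangular_ring_carrierD(1)[OF B] m_comm)
qed (use assms scalar_mat_closed in auto)

text \<open>This is the \<open>R\<close>-algebra structure of the double commutant, which allows the
  results on annihilated elements to be applied to \<open>A\<close>.\<close>

lemma (in cring) ring_hom_cring_scalar_mat:
  assumes "A \<in> carrier (upper_triangular_ring n R)"
  shows "ring_hom_cring R ((upper_triangular_ring n R)\<lparr>carrier := ring_comm2 (upper_triangular_ring n R) A\<rparr>)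
    (scalar_mat n R)"
proof -
  interpret T: ring "upper_triangular_ring n R"
    by (rule ring_upper_triangular_ring)
  note clo = scalar_mat_closed[where n = n]
  have "scalar_mat n R (r \<otimes> s) = scalar_mat n R r \<otimes>\<^bsub>upper_triangular_ring n R\<^esub> scalar_mat n R s"
    "scalar_mat n R (r \<oplus> s) = scalar_mat n R r \<oplus>\<^bsub>upper_triangular_ring n R\<^esub> scalar_mat n R s"
    if "r \<in> carrier R" "s \<in> carrier R" for r s
    using that clo
    by (auto intro!: upper_triangular_ring_eqI[where n = n and R = R]
        simp: scalar_mat_mult_index[OF clo]) (auto simp: upper_triangular_ring_index)
  moreover have "scalar_mat n R \<one> = \<one>\<^bsub>upper_triangular_ring n R\<^esub>"
    by (simp add: scalar_mat_def upper_triangular_ring_def)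
  ultimately have "scalar_mat n R \<in> Ring.ring_hom R
      ((upper_triangular_ring n R)\<lparr>carrier := ring_comm2 (upper_triangular_ring n R) A\<rparr>)"
    using scalar_mat_ring_comm2[OF assms] by (auto simp: Ring.ring_hom_def)
  then show ?thesis
    using T.cring_ring_comm2[OF assms]
    by (simp add: ring_hom_cring_def ring_hom_cring_axioms_def is_cring)
qed

lemma (in ring) ring_hom_ring_diag:
  assumes "i < n"
  shows "ring_hom_ring (upper_triangular_ring n R) R (\<lambda>B. B $$ (i, i))"
  using assms ring_upper_triangular_ring
  by (intro ring_hom_ringI)
     (auto simp: upper_triangular_diag_mult upper_triangular_ring_carrierD(1) upper_triangular_ring_index(1,4) ring_axioms)

text \<open>These maps are the retractions \<open>g\<close> needed in
  \<open>exists_idempotent_of_annihilated\<close>.\<close>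

lemma (in cring) ring_hom_cring_diag:
  assumes "i < n" "A \<in> carrier (upper_triangular_ring n R)"
  shows "ring_hom_cring ((upper_triangular_ring n R)\<lparr>carrier := ring_comm2 (upper_triangular_ring n R) A\<rparr>) R
    (\<lambda>B. B $$ (i, i))"
proof -
  interpret T: ring "upper_triangular_ring n R"
    by (rule ring_upper_triangular_ring)
  interpret d: ring_hom_ring "upper_triangular_ring n R" R "\<lambda>B. B $$ (i, i)"
    by (rule ring_hom_ring_diag) fact
  have "(\<lambda>B. B $$ (i, i)) \<in> Ring.ring_hom
      ((upper_triangular_ring n R)\<lparr>carrier := ring_comm2 (upper_triangular_ring n R) A\<rparr>) R"
    using ring_comm2D(1)[of _ "upper_triangular_ring n R" A]
    by (auto simp: Ring.ring_hom_def)
  then show ?thesis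
    using T.cring_ring_comm2[OF assms(2)]
    by (simp add: ring_hom_cring_def ring_hom_cring_axioms_def is_cring)
qed

section \<open>Cayley-Hamilton and the radical of the triangular ring\<close>

text \<open>Each further factor clears one more column: the product of the first \<open>m\<close>
  factors vanishes in its first \<open>m\<close> columns.\<close>

lemma (in cring) upper_triangular_cayley_hamilton:
  assumes A: "A \<in> carrier (upper_triangular_ring n R)"
  defines "C \<equiv> (upper_triangular_ring n R)\<lparr>carrier := ring_comm2 (upper_triangular_ring n R) A\<rparr>"
  shows "(\<Otimes>\<^bsub>C\<^esub>i\<in>{..<n}. A \<oplus>\<^bsub>C\<^esub> scalar_mat n R (\<ominus> (A $$ (i, i)))) = \<zero>\<^bsub>C\<^esub>"
proof -
  interpret T: ring "upper_triangular_ring n R"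
    by (rule ring_upper_triangular_ring)
  interpret h: ring_hom_cring R C "scalar_mat n R"
    unfolding C_def by (rule ring_hom_cring_scalar_mat) fact
  note AD = upper_triangular_ring_carrierD[OF A]
  have CT: "B \<in> carrier (upper_triangular_ring n R)" if "B \<in> carrier C" for B
    using that by (simp add: C_def ring_comm2D(1))
  have AC: "A \<in> carrier C"
    by (simp add: C_def ring_comm2I A)
  define F where "F k = A \<oplus>\<^bsub>C\<^esub> scalar_mat n R (\<ominus> (A $$ (k, k)))" for k
  have Fc: "F k \<in> carrier C" if "k < n" for k
    using that AC AD(1) by (simp add: F_def)
  have Findex: "F k $$ (i, j) = A $$ (i, j) \<oplus> (if i = j then \<ominus> (A $$ (k, k)) else \<zero>)" if "i < n" "j < n" for i j k
    using that by (simp add: F_def C_def upper_triangular_ring_index)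
  have "finprod C F {..<m} $$ (i, j) = \<zero>" if "m \<le> n" "i < n" "j < m" for m i j
    using that
  proof (induction m arbitrary: i j)
    case (Suc m)
    define B where "B = finprod C F {..<m}"
    have FC: "F \<in> {..<m} \<rightarrow> carrier C" "F m \<in> carrier C"
      using Suc.prems Fc by auto
    have Bc: "B \<in> carrier C"
      unfolding B_def using FC by (intro h.S.finprod_closed)
    note BD = upper_triangular_ring_carrierD[OF CT[OF Bc]]
    \<comment> \<open>Commutativity of \<open>C\<close> puts the new factor on the right, so that
      the zero columns of \<open>B\<close> can be used.\<close>
    have "finprod C F {..<Suc m} = B \<otimes>\<^bsub>C\<^esub> F m"
      using FC Bc by (simp add: lessThan_Suc B_def h.S.m_comm)
    then have "finprod C F {..<Suc m} $$ (i, j) = (\<Oplus>k\<in>{..<n}. B $$ (i, k) \<otimes> F m $$ (k, j))"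
      using Suc.prems by (simp add: C_def upper_triangular_ring_index)
    also have "\<dots> = (\<Oplus>k\<in>{..<n}. \<zero>)"
    proof (rule finsum_cong')
      fix k assume k: "k \<in> {..<n}"
      show "B $$ (i, k) \<otimes> F m $$ (k, j) = \<zero>"
      proof (cases "k < m")
        case True
        then show ?thesis
          using Suc.IH[of i k] Suc.prems k upper_triangular_ring_carrierD(1)[OF CT[OF FC(2)]]
          by (simp add: B_def)
      next
        case False
        \<comment> \<open>Here \<open>j \<le> m \<le> k\<close>. The position is either below the
          diagonal or \<open>(m, m)\<close>, where \<open>F m\<close> is zero by
          construction.\<close>
        then have "F m $$ (k, j) = \<zero>"
          using Suc.prems k AD(1)[of k k] AD(2)[of k j] by (cases "j = m") (auto simp: Findex r_neg)
        then show ?thesis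
          using BD(1) Suc.prems k by simp
      qed
    qed auto
    finally show ?case by simp
  qed simp
  then have "finprod C F {..<n} = \<zero>\<^bsub>upper_triangular_ring n R\<^esub>"
    using Fc by (intro upper_triangular_ring_eqI[where n = n and R = R])
       (auto simp: upper_triangular_ring_index intro!: CT h.S.finprod_closed)
  moreover have "F = (\<lambda>i. A \<oplus>\<^bsub>C\<^esub> scalar_mat n R (\<ominus> (A $$ (i, i))))"
    by (rule ext) (simp add: F_def)
  ultimately show ?thesis
    by (simp add: C_def)
qed

text \<open>By the Cayley-Hamilton identity \<open>A\<close> is annihilated by linear factors with
  unit constants, so it is invertible already in its double commutant.\<close>

lemma (in cring) upper_triangular_left_inverse:
  assumes A: "A \<in> carrier (upper_triangular_ring n R)"
    and diag: "\<And>i. i < n \<Longrightarrow> A $$ (i, i) \<in> Units R"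
  shows "\<exists>B\<in>carrier (upper_triangular_ring n R). B \<otimes>\<^bsub>upper_triangular_ring n R\<^esub> A = \<one>\<^bsub>upper_triangular_ring n R\<^esub>"
proof -
  interpret h: ring_hom_cring R
    "(upper_triangular_ring n R)\<lparr>carrier := ring_comm2 (upper_triangular_ring n R) A\<rparr>" "scalar_mat n R"
    by (rule ring_hom_cring_scalar_mat) fact
  have "A \<in> Units ((upper_triangular_ring n R)\<lparr>carrier := ring_comm2 (upper_triangular_ring n R) A\<rparr>)"
    using A diag upper_triangular_cayley_hamilton[OF A]
    by (intro h.Units_of_annihilated[of _ "{..<n}" "\<lambda>i. A $$ (i, i)"]) (auto simp: ring_comm2I)
  then show ?thesis
    by (auto simp: Units_def dest: ring_comm2D(1))
qed

text \<open>Forwards, each diagonal entry is a surjective homomorphism, with scalar matrices as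
  preimages. Backwards, \<open>\<one> \<oplus> S \<otimes> A\<close> has units on its diagonal for
  every \<open>S\<close>, hence a left inverse.\<close>

lemma (in cring) jacobson_radical_upper_triangular_ring_iff:
  assumes A: "A \<in> carrier (upper_triangular_ring n R)"
  shows "A \<in> jacobson_radical (upper_triangular_ring n R) \<longleftrightarrow>
    (\<forall>i<n. A $$ (i, i) \<in> jacobson_radical R)"
proof
  interpret T: ring "upper_triangular_ring n R"
    by (rule ring_upper_triangular_ring)
  show "\<forall>i<n. A $$ (i, i) \<in> jacobson_radical R" if J: "A \<in> jacobson_radical (upper_triangular_ring n R)"
  proof (intro allI impI)
    fix i assume i: "i < n"
    have "r \<in> (\<lambda>B. B $$ (i, i)) ` carrier (upper_triangular_ring n R)" if "r \<in> carrier R" for r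
      using that i by (intro image_eqI[of _ _ "scalar_mat n R r"])
        (auto simp: upper_triangular_ring_index scalar_mat_closed)
    then have "(\<lambda>B. B $$ (i, i)) ` carrier (upper_triangular_ring n R) = carrier R"
      using i upper_triangular_ring_carrierD(1) by blast
    then show "A $$ (i, i) \<in> jacobson_radical R"
      using T.jacobson_radical_surj_ring_hom[OF ring_hom_ring_diag[OF i] _ J] by simp
  qed
  assume J: "\<forall>i<n. A $$ (i, i) \<in> jacobson_radical R"
  show "A \<in> jacobson_radical (upper_triangular_ring n R)"
  proof (rule T.jacobson_radicalI[OF A])
    fix S assume S: "S \<in> carrier (upper_triangular_ring n R)"
    show "\<exists>B\<in>carrier (upper_triangular_ring n R).
        B \<otimes>\<^bsub>upper_triangular_ring n R\<^esub> (\<one>\<^bsub>upper_triangular_ring n R\<^esub> \<oplus>\<^bsub>upper_triangular_ring n R\<^esub> S \<otimes>\<^bsub>upper_triangular_ring n R\<^esub> A) = \<one>\<^bsub>upper_triangular_ring n R\<^esub>"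
    proof (rule upper_triangular_left_inverse)
      fix i assume i: "i < n"
      have "(\<one>\<^bsub>upper_triangular_ring n R\<^esub> \<oplus>\<^bsub>upper_triangular_ring n R\<^esub> S \<otimes>\<^bsub>upper_triangular_ring n R\<^esub> A) $$ (i, i)
          = \<one> \<oplus> S $$ (i, i) \<otimes> A $$ (i, i)"
        using i S A by (simp add: upper_triangular_diag_mult upper_triangular_ring_index(1,4))
      also have "\<dots> \<in> Units R"
        using J i upper_triangular_ring_carrierD(1)[OF S] by (intro jacobson_radical_imp_Units) auto
      finally show "(\<one>\<^bsub>upper_triangular_ring n R\<^esub> \<oplus>\<^bsub>upper_triangular_ring n R\<^esub> S \<otimes>\<^bsub>upper_triangular_ring n R\<^esub> A) $$ (i, i) \<in> Units R" .
    qed (use S A in simp)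
  qed
qed

section \<open>Perfect J-cleanness and the diagonal\<close>

lemma (in cring) perfectly_J_clean_iff:
  "perfectly_J_clean R a \<longleftrightarrow>
    a \<in> carrier R \<and> (\<exists>e\<in>carrier R. e \<otimes> e = e \<and> a \<ominus> e \<in> jacobson_radical R)"
proof -
  have "ring_comm2 R a = carrier R"
    by (auto simp: ring_comm2_def ring_comm_def m_comm)
  then show ?thesis
    by (simp add: perfectly_J_clean_def)
qed

theorem theorem4p11:
  fixes R :: "('a, 'm) ring_scheme" and n :: nat and A :: "'a mat"
  assumes "cring R"
    and "n > 0"
    and "A \<in> carrier (upper_triangular_ring n R)"
    and "\<one>\<^bsub>R\<^esub> \<oplus>\<^bsub>R\<^esub> \<one>\<^bsub>R\<^esub> \<in> jacobson_radical R"
  shows "perfectly_J_clean (upper_triangular_ring n R) A \<longleftrightarrow>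
    (\<forall>i<n. perfectly_J_clean R (A $$ (i, i)))"
proof -
  interpret cring R by fact
  let ?T = "upper_triangular_ring n R"
  interpret T: ring ?T
    by (rule ring_upper_triangular_ring)
  note A = assms(3)
  note AD = upper_triangular_ring_carrierD[OF A]
  have radical: "A \<ominus>\<^bsub>?T\<^esub> E \<in> jacobson_radical ?T \<longleftrightarrow>
      (\<forall>i<n. A $$ (i, i) \<ominus>\<^bsub>R\<^esub> E $$ (i, i) \<in> jacobson_radical R)" if E: "E \<in> carrier ?T" for E
  proof -
    have "(A \<ominus>\<^bsub>?T\<^esub> E) $$ (i, i) = A $$ (i, i) \<ominus>\<^bsub>R\<^esub> E $$ (i, i)" if "i < n" for i
    proof -
      interpret d: ring_hom_ring ?T R "\<lambda>B. B $$ (i, i)"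
        by (rule ring_hom_ring_diag) fact
      show ?thesis
        using d.hom_add[of A "\<ominus>\<^bsub>?T\<^esub> E"] d.hom_a_inv[of E] A E by (simp add: T.minus_eq minus_eq)
    qed
    then show ?thesis
      using jacobson_radical_upper_triangular_ring_iff[of "A \<ominus>\<^bsub>?T\<^esub> E" n] A E by simp
  qed
  show ?thesis
  proof
    assume "perfectly_J_clean ?T A"
    then obtain E where "E \<in> ring_comm2 ?T A" and EE: "E \<otimes>\<^bsub>?T\<^esub> E = E"
      and J: "A \<ominus>\<^bsub>?T\<^esub> E \<in> jacobson_radical ?T"
      by (auto simp: perfectly_J_clean_def)
    then have E: "E \<in> carrier ?T"
      by (simp add: ring_comm2D(1))
    show "\<forall>i<n. perfectly_J_clean R (A $$ (i, i))"
    proof (intro allI impI)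
      fix i assume i: "i < n"
      \<comment> \<open>The diagonal entry of \<open>E\<close> is the required idempotent; over the
        commutative \<open>R\<close> it is automatically in the double commutant.\<close>
      have "E $$ (i, i) \<otimes>\<^bsub>R\<^esub> E $$ (i, i) = E $$ (i, i)"
        using upper_triangular_diag_mult[OF E E i] EE by simp
      then show "perfectly_J_clean R (A $$ (i, i))"
        using i J radical[OF E] AD(1) upper_triangular_ring_carrierD(1)[OF E]
        by (auto simp: perfectly_J_clean_iff)
    qed
  next
    assume "\<forall>i<n. perfectly_J_clean R (A $$ (i, i))"
    then obtain e where e: "\<And>i. i < n \<Longrightarrow> e i \<in> carrier R" "\<And>i. i < n \<Longrightarrow> e i \<otimes>\<^bsub>R\<^esub> e i = e i"
      and J: "\<And>i. i < n \<Longrightarrow> A $$ (i, i) \<ominus>\<^bsub>R\<^esub> e i \<in> jacobson_radical R"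
      unfolding perfectly_J_clean_iff by metis
    let ?C = "?T\<lparr>carrier := ring_comm2 ?T A\<rparr>"
    interpret h: ring_hom_cring R ?C "scalar_mat n R"
      by (rule ring_hom_cring_scalar_mat) fact
    have "\<exists>E\<in>carrier ?C. E \<otimes>\<^bsub>?C\<^esub> E = E \<and> (\<forall>g i. i \<in> {..<n} \<longrightarrow> ring_hom_cring ?C R g \<longrightarrow>
        (\<forall>r\<in>carrier R. g (scalar_mat n R r) = r) \<longrightarrow> g A = A $$ (i, i) \<longrightarrow> g E = e i)"
      using e J AD(1) upper_triangular_cayley_hamilton[OF A]
      by (intro h.exists_idempotent_of_annihilated[where a = "\<lambda>i. A $$ (i, i)"]) (auto simp: ring_comm2I A)
    then obtain E where E: "E \<in> ring_comm2 ?T A" "E \<otimes>\<^bsub>?T\<^esub> E = E"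
      and Eg: "\<And>g i. i < n \<Longrightarrow> ring_hom_cring ?C R g \<Longrightarrow>
        (\<forall>r\<in>carrier R. g (scalar_mat n R r) = r) \<Longrightarrow> g A = A $$ (i, i) \<Longrightarrow> g E = e i"
      by auto
    \<comment> \<open>The diagonal map qualifies as \<open>g\<close>: it recovers \<open>r\<close>
      from its scalar matrix and sends \<open>A\<close> to its own diagonal entry.\<close>
    have "E $$ (i, i) = e i" if "i < n" for i
      using that by (intro Eg[where g = "\<lambda>B. B $$ (i, i)"] ring_hom_cring_diag A)
        (auto simp: upper_triangular_ring_index)
    then have "A \<ominus>\<^bsub>?T\<^esub> E \<in> jacobson_radical ?T"
      using radical[OF ring_comm2D(1)[OF E(1)]] J by simp
    then show "perfectly_J_clean ?T A"
      using A E by (auto simp: perfectly_J_clean_def)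
  qed
qed

end
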